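(* If there is a nontrivial automorphism of $\mathcal P(\omega)/\mathrm{Fin}$, then either there is a nontrivial automorphism $\phi$ of $\mathcal P(\omega)/\mathrm{Fin}$ with $\phi\circ\sigma=\sigma\circ\phi$, or there is a nontrivial automorphism $\psi$ of $\mathcal P(\omega)/\mathrm{Fin}$ such that $\langle\mathcal P(\omega)/\mathrm{Fin},\psi\rangle$ and $\langle\mathcal P(\omega)/\mathrm{Fin},\sigma\rangle$ are conjugate.
   Context: $\mathcal P(\omega)/\mathrm{Fin}$ is $\mathcal P(\omega)$ modulo finite sets, $\sigma([A])=[A+1]$. An automorphism $\tau$ of $\mathcal P(\omega)/\mathrm{Fin}$ is trivial if there is a function $t:\omega\to\omega$ with $\tau([A])=[t[A]]$ for all $A\subseteq\omega$; otherwise nontrivial. Systems $\langle\mathbb A,\alpha\rangle,\langle\mathbb B,\beta\rangle$ are conjugate if some Boolean isomorphism $\phi:\mathbb A\to\mathbb B$ satisfies $\phi\circ\alpha=\beta\circ\phi$. No hypothesis beyond ZFC. *)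

theory Defs
  imports Main
begin

definition almost_eq :: "nat set \<Rightarrow> nat set \<Rightarrow> bool"
  where "almost_eq A B \<longleftrightarrow> finite (sym_diff A B)"

lemma equivp_almost_eq: "equivp almost_eq"
proof (rule equivpI)
  show "reflp almost_eq" "symp almost_eq"
    by (auto simp: reflp_def symp_def almost_eq_def Un_commute)
  show "transp almost_eq"
  proof (rule transpI)
    fix A B C assume "almost_eq A B" "almost_eq B C"
    then have "finite (sym_diff A B \<union> sym_diff B C)" by (simp add: almost_eq_def)
    then show "almost_eq A C" unfolding almost_eq_def by (rule rev_finite_subset) auto
  qed
qed

text \<open>The Boolean algebra \<open>P(\<omega>)/Fin\<close>, with \<open>[A]\<close> written \<open>pfin_class A\<close>.\<close>

quotient_type pfin = "nat set" / almost_eq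
  morphisms rep_pfin pfin_class
  by (rule equivp_almost_eq)

instantiation pfin :: boolean_algebra
begin

lift_definition bot_pfin :: pfin is "{}" .

lift_definition top_pfin :: pfin is UNIV .

lift_definition uminus_pfin :: "pfin \<Rightarrow> pfin" is uminus
proof -
  fix A B assume "almost_eq A B"
  moreover have "sym_diff (- A) (- B) = sym_diff A B" by auto
  ultimately show "almost_eq (- A) (- B)" by (simp only: almost_eq_def)
qed

lift_definition inf_pfin :: "pfin \<Rightarrow> pfin \<Rightarrow> pfin" is "(\<inter>)"
proof -
  fix A A' B B' assume "almost_eq A A'" "almost_eq B B'"
  then have "finite (sym_diff A A' \<union> sym_diff B B')" by (simp add: almost_eq_def)
  then show "almost_eq (A \<inter> B) (A' \<inter> B')" unfolding almost_eq_def by (rule rev_finite_subset) auto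
qed

lift_definition sup_pfin :: "pfin \<Rightarrow> pfin \<Rightarrow> pfin" is "(\<union>)"
proof -
  fix A A' B B' assume "almost_eq A A'" "almost_eq B B'"
  then have "finite (sym_diff A A' \<union> sym_diff B B')" by (simp add: almost_eq_def)
  then show "almost_eq (A \<union> B) (A' \<union> B')" unfolding almost_eq_def by (rule rev_finite_subset) auto
qed

lift_definition minus_pfin :: "pfin \<Rightarrow> pfin \<Rightarrow> pfin" is "(-)"
proof -
  fix A A' B B' assume "almost_eq A A'" "almost_eq B B'"
  then have "finite (sym_diff A A' \<union> sym_diff B B')" by (simp add: almost_eq_def)
  then show "almost_eq (A - B) (A' - B')" unfolding almost_eq_def by (rule rev_finite_subset) auto
qed

lift_definition less_eq_pfin :: "pfin \<Rightarrow> pfin \<Rightarrow> bool" is "\<lambda>A B. finite (A - B)"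
proof -
  fix A A' B B' assume *: "almost_eq A A'" "almost_eq B B'"
  then have fin: "finite (sym_diff A A' \<union> sym_diff B B')" by (simp add: almost_eq_def)
  have "A - B \<subseteq> (A' - B') \<union> (sym_diff A A' \<union> sym_diff B B')"
    "A' - B' \<subseteq> (A - B) \<union> (sym_diff A A' \<union> sym_diff B B')" by auto
  with fin show "finite (A - B) = finite (A' - B')" by (meson finite_Un finite_subset)
qed

definition less_pfin :: "pfin \<Rightarrow> pfin \<Rightarrow> bool"
  where "less_pfin x y \<longleftrightarrow> x \<le> y \<and> \<not> y \<le> x"

instance
proof
  fix x y z :: pfin
  show "x < y \<longleftrightarrow> x \<le> y \<and> \<not> y \<le> x" by (rule less_pfin_def)
  show "x \<le> x" by transfer simp
  show "x \<le> z" if "x \<le> y" "y \<le> z" using that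
  proof transfer
    fix A B C :: "nat set" assume "finite (A - B)" "finite (B - C)"
    then have "finite ((A - B) \<union> (B - C))" by simp
    then show "finite (A - C)" by (rule rev_finite_subset) auto
  qed
  show "x = y" if "x \<le> y" "y \<le> x" using that
    by transfer (simp add: almost_eq_def)
  show "inf x y \<le> x"
  proof transfer
    fix A B :: "nat set"
    have "A \<inter> B - A = {}" by blast
    then show "finite (A \<inter> B - A)" by (simp only: finite.emptyI)
  qed
  show "inf x y \<le> y"
  proof transfer
    fix A B :: "nat set"
    have "A \<inter> B - B = {}" by blast
    then show "finite (A \<inter> B - B)" by (simp only: finite.emptyI)
  qed
  show "x \<le> sup x y" by transfer (simp only: Diff_cancel Diff_Un Int_empty_left finite.emptyI)
  show "y \<le> sup x y" by transfer (simp only: Diff_cancel Diff_Un Int_empty_right finite.emptyI)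
  show "bot \<le> x" by transfer (simp only: empty_Diff finite.emptyI)
  show "x \<le> top" by transfer (simp only: Diff_UNIV finite.emptyI)
  show "x \<le> inf y z" if "x \<le> y" "x \<le> z" using that
    by transfer (simp add: Diff_Int)
  show "sup y z \<le> x" if "y \<le> x" "z \<le> x" using that
    by transfer (simp add: Un_Diff)
  show "sup x (inf y z) = inf (sup x y) (sup x z)"
    by transfer (simp add: Un_Int_distrib almost_eq_def)
  show "inf x (- x) = bot" "sup x (- x) = top"
    by (transfer; simp add: almost_eq_def)+
  show "x - y = inf x (- y)" by transfer (simp add: Diff_eq almost_eq_def)
qed

end

lift_definition shift :: "pfin \<Rightarrow> pfin" is "image Suc"
proof -
  fix A B assume "almost_eq A B"
  then have "finite (Suc ` sym_diff A B)" by (simp add: almost_eq_def)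
  then show "almost_eq (Suc ` A) (Suc ` B)" unfolding almost_eq_def
    by (rule rev_finite_subset) auto
qed

definition boolean_isomorphism :: "('a::boolean_algebra \<Rightarrow> 'b::boolean_algebra) \<Rightarrow> bool"
  where "boolean_isomorphism \<phi> \<longleftrightarrow> bij \<phi> \<and>
    (\<forall>x y. \<phi> (inf x y) = inf (\<phi> x) (\<phi> y)) \<and>
    (\<forall>x y. \<phi> (sup x y) = sup (\<phi> x) (\<phi> y)) \<and>
    (\<forall>x. \<phi> (- x) = - \<phi> x) \<and> \<phi> bot = bot \<and> \<phi> top = top"

abbreviation boolean_automorphism :: "('a::boolean_algebra \<Rightarrow> 'a) \<Rightarrow> bool"
  where "boolean_automorphism \<equiv> boolean_isomorphism"

definition conjugate ::
    "('a::boolean_algebra \<Rightarrow> 'a) \<Rightarrow> ('b::boolean_algebra \<Rightarrow> 'b) \<Rightarrow> bool"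
  where "conjugate \<alpha> \<beta> \<longleftrightarrow> (\<exists>\<phi>. boolean_isomorphism \<phi> \<and> \<phi> \<circ> \<alpha> = \<beta> \<circ> \<phi>)"

text \<open>The map \<open>t\<close> is total and otherwise arbitrary; when \<open>\<tau>\<close> is an automorphism, it is
  automatically an almost permutation of \<open>\<omega>\<close>.\<close>

definition trivial :: "(pfin \<Rightarrow> pfin) \<Rightarrow> bool"
  where "trivial \<tau> \<longleftrightarrow> (\<exists>t :: nat \<Rightarrow> nat. \<forall>A. \<tau> (pfin_class A) = pfin_class (t ` A))"

definition nontrivial_automorphism :: "(pfin \<Rightarrow> pfin) \<Rightarrow> bool"
  where "nontrivial_automorphism \<tau> \<longleftrightarrow> boolean_automorphism \<tau> \<and> \<not> trivial \<tau>"

lemma boolean_automorphism_shift: "boolean_automorphism shift"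
proof -
  have "inj shift"
  proof (rule injI)
    fix x y assume "shift x = shift y"
    then show "x = y"
    proof transfer
      fix A B assume "almost_eq (Suc ` A) (Suc ` B)"
      then have "finite (Suc ` sym_diff A B)"
        by (simp add: almost_eq_def image_Un image_set_diff)
      then show "almost_eq A B"
        unfolding almost_eq_def by (rule finite_imageD) simp
    qed
  qed
  moreover have "surj shift"
  proof -
    have "\<exists>x. y = shift x" for y
    proof transfer
      fix B :: "nat set"
      have "sym_diff B (Suc ` (Suc -` B)) \<subseteq> {0}"
      proof
        fix n assume "n \<in> sym_diff B (Suc ` (Suc -` B))"
        then show "n \<in> {0}" by (cases n) auto
      qed
      then have "almost_eq B (Suc ` (Suc -` B))"
        unfolding almost_eq_def by (rule finite_subset) simp
      then show "\<exists>A. almost_eq B (Suc ` A)" ..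
    qed
    then show ?thesis by (simp add: surj_def)
  qed
  moreover have "shift (- x) = - shift x" for x
  proof transfer
    fix A :: "nat set"
    have "sym_diff (Suc ` (- A)) (- Suc ` A) \<subseteq> {0}"
    proof
      fix n assume "n \<in> sym_diff (Suc ` (- A)) (- Suc ` A)"
      then show "n \<in> {0}" by (cases n) auto
    qed
    then show "almost_eq (Suc ` (- A)) (- Suc ` A)"
      unfolding almost_eq_def by (rule finite_subset) simp
  qed
  moreover have "shift top = top"
  proof transfer
    have "sym_diff (range Suc) UNIV \<subseteq> {0}"
    proof
      fix n assume "n \<in> sym_diff (range Suc) UNIV"
      then show "n \<in> {0}" by (cases n) auto
    qed
    then show "almost_eq (range Suc) UNIV"
      unfolding almost_eq_def by (rule finite_subset) simp
  qed
  moreover have "shift (inf x y) = inf (shift x) (shift y)" for x y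
    by transfer (simp add: image_Int almost_eq_def)
  moreover have "shift (sup x y) = sup (shift x) (shift y)" for x y
    by transfer (simp add: image_Un almost_eq_def)
  moreover have "shift bot = bot" by transfer (simp add: almost_eq_def)
  ultimately show ?thesis
    unfolding boolean_isomorphism_def by (simp add: bij_def)
qed

end

(* Assume that every conjugate of the shift is trivial and let tau be any automorphism. A suitable
   product of infinitely many disjoint three-cycles is a quotient of two transitive shifts, so tau
   conjugates such permutations to trivial automorphisms. Split omega into infinitely many infinite
   columns C_n, and let two of these permutations act on each column so that it is connected and
   one-ended. Then tau carries [C_n] to the class of a set with an infinite connected part for the
   conjugated action. The image of a union of columns has only finitely many boundary points, so it
   contains or misses almost all of these connected parts entirely; a point x_n chosen in the n-th
   part thus encodes the index n. Hence the inverse of tau is trivial below {x_n : n}, so tau is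
   trivial below some infinite set. Three-cycles move this set around, and tau is trivial everywhere.
   In particular the second alternative always holds. *)

theory Submission
  imports Defs "HOL-Library.Infinite_Set" "HOL-Library.Nat_Bijection"
begin

section \<open>Automorphisms of the quotient algebra\<close>

text \<open>Images under an arbitrary total map respect finite changes, so trivial maps are exactly
  those of the form \<open>pim t\<close> and compose like point maps.\<close>

lift_definition pim :: "(nat \<Rightarrow> nat) \<Rightarrow> pfin \<Rightarrow> pfin" is image
proof -
  fix f :: "nat \<Rightarrow> nat" and A B assume "almost_eq A B"
  then have "finite (f ` sym_diff A B)" by (simp add: almost_eq_def)
  then show "almost_eq (f ` A) (f ` B)" unfolding almost_eq_def
    by (rule rev_finite_subset) auto
qed

lemma pim_class [simp]: "pim f (pfin_class A) = pfin_class (f ` A)"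
  by (rule pim.abs_eq)

lemma pfin_class_eq_iff: "pfin_class A = pfin_class B \<longleftrightarrow> finite (A - B) \<and> finite (B - A)"
  by (simp add: pfin.abs_eq_iff almost_eq_def)

lemma pfin_class_eq_bot_iff: "pfin_class A = bot \<longleftrightarrow> finite A"
  by (simp add: bot_pfin.abs_eq pfin_class_eq_iff)

lemma pfin_class_le_iff: "pfin_class A \<le> pfin_class B \<longleftrightarrow> finite (A - B)"
  by (rule less_eq_pfin.abs_eq)

lemma pfin_cases: obtains A where "x = pfin_class A"
  using that by (induct x rule: pfin.abs_induct) blast

lemma pfin_ext: "(\<And>A. f (pfin_class A) = g (pfin_class A)) \<Longrightarrow> f = g"
  by (rule ext) (metis pfin_cases)

lemma trivial_iff_pim: "trivial \<tau> \<longleftrightarrow> (\<exists>t. \<tau> = pim t)"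
  unfolding trivial_def by (metis pfin_ext pim_class)

lemma pim_comp: "pim f \<circ> pim g = pim (f \<circ> g)"
  by (rule pfin_ext) (simp add: image_comp)

lemma pim_pim: "pim f (pim g x) = pim (f \<circ> g) x"
  by (metis comp_apply pim_comp)

lemma pim_id: "pim id = id"
  by (rule pfin_ext) simp

lemma shift_eq_pim: "shift = pim Suc"
  by (rule pfin_ext) (simp add: shift.abs_eq)

lemma trivial_comp: "trivial \<rho> \<Longrightarrow> trivial \<tau> \<Longrightarrow> trivial (\<rho> \<circ> \<tau>)"
  unfolding trivial_iff_pim by (auto simp: pim_comp)

lemma boolean_isomorphism_comp:
  assumes "boolean_isomorphism \<rho>" "boolean_isomorphism \<tau>"
  shows "boolean_isomorphism (\<rho> \<circ> \<tau>)"
  using assms unfolding boolean_isomorphism_def by (auto intro: bij_comp)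

lemma boolean_isomorphism_inv:
  assumes "boolean_isomorphism \<tau>"
  shows "boolean_isomorphism (inv \<tau>)"
proof -
  have bij: "bij \<tau>"
    and ops: "\<And>x y. \<tau> (inf x y) = inf (\<tau> x) (\<tau> y)" "\<And>x y. \<tau> (sup x y) = sup (\<tau> x) (\<tau> y)"
      "\<And>x. \<tau> (- x) = - \<tau> x" "\<tau> bot = bot" "\<tau> top = top"
    using assms unfolding boolean_isomorphism_def by auto
  have inv_eq: "inv \<tau> y = x" if "y = \<tau> x" for x y
    using bij that by (simp add: bij_is_inj)
  have right: "\<tau> (inv \<tau> x) = x" for x
    using bij by (simp add: bij_is_surj surj_f_inv_f)
  show ?thesis
    unfolding boolean_isomorphism_def
    using bij_imp_bij_inv[OF bij] by (auto intro!: inv_eq simp: ops right)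
qed

lemma boolean_isomorphism_le_iff:
  assumes "boolean_isomorphism \<tau>"
  shows "\<tau> x \<le> \<tau> y \<longleftrightarrow> x \<le> y"
proof -
  have "inj \<tau>" "\<tau> (inf x y) = inf (\<tau> x) (\<tau> y)"
    using assms unfolding boolean_isomorphism_def by (auto simp: bij_is_inj)
  then show ?thesis by (metis inf.orderE inf.cobounded2 injD)
qed

lemma boolean_isomorphism_pim:
  assumes "bij e"
  shows "boolean_isomorphism (pim e)"
proof -
  have "pim e \<circ> pim (inv e) = id" "pim (inv e) \<circ> pim e = id"
    using assms by (simp_all add: pim_comp pim_id bij_is_inj bij_is_surj surj_iff[THEN iffD1])
  then have "bij (pim e)" using o_bij by blast
  moreover have "pim e (inf x y) = inf (pim e x) (pim e y)"
    "pim e (sup x y) = sup (pim e x) (pim e y)" "pim e (- x) = - pim e x"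
    "pim e bot = bot" "pim e top = top" for x y
    using assms
    by (transfer; simp add: image_Int image_Un bij_is_inj bij_is_surj bij_image_Compl_eq almost_eq_def)+
  ultimately show ?thesis unfolding boolean_isomorphism_def by auto
qed

lemma finite_compl_range:
  assumes "boolean_automorphism (pim t)"
  shows "finite (- range t)"
proof -
  have "pim t top = top" using assms by (simp add: boolean_isomorphism_def)
  then show ?thesis by (simp add: top_pfin.abs_eq pfin_class_eq_iff Compl_eq_Diff_UNIV)
qed

text \<open>A fibre has at most one image point, so its class is sent to \<open>bot\<close>;
  injectivity of \<open>pim t\<close> then forces the class itself to be \<open>bot\<close>.\<close>

lemma finite_vimage_singleton:
  assumes "boolean_automorphism (pim t)"
  shows "finite (t -` {y})"
proof -
  have "pim t (pfin_class (t -` {y})) = bot"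
    by (simp add: pfin_class_eq_bot_iff) (rule finite_subset[of _ "{y}"], auto)
  moreover have "inj (pim t)" "pim t bot = bot"
    using assms by (auto simp: boolean_isomorphism_def bij_is_inj)
  ultimately have "pfin_class (t -` {y}) = bot" by (metis injD)
  then show ?thesis by (simp add: pfin_class_eq_bot_iff)
qed

text \<open>Although \<open>t\<close> need not be injective, \<open>inv t\<close> is a right inverse
  of it on the cofinite set \<open>range t\<close>. Hence \<open>pim (inv t)\<close> is a right
  inverse of the bijection \<open>pim t\<close>, and so its inverse.\<close>

lemma trivial_inv:
  assumes "boolean_automorphism \<tau>" "trivial \<tau>"
  shows "trivial (inv \<tau>)"
proof -
  obtain t where t: "\<tau> = pim t" using assms by (auto simp: trivial_iff_pim)
  have bij: "bij \<tau>" using assms by (simp add: boolean_isomorphism_def)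
  have fin: "finite (- range t)" using finite_compl_range assms t by simp
  have "\<tau> (pim (inv t) x) = x" for x
  proof (cases x rule: pfin_cases)
    case (1 B)
    have t_inv: "t (inv t y) = y" if "y \<in> range t" for y
      using that by (rule f_inv_into_f)
    have "t ` inv t ` B - B \<subseteq> t ` inv t ` (- range t)"
    proof
      fix x assume "x \<in> t ` inv t ` B - B"
      then obtain y where "y \<in> B" "x = t (inv t y)" "x \<notin> B" by auto
      moreover from this have "y \<notin> range t" using t_inv by metis
      ultimately show "x \<in> t ` inv t ` (- range t)" by blast
    qed
    moreover have "B - t ` inv t ` B \<subseteq> - range t"
    proof
      fix y assume "y \<in> B - t ` inv t ` B"
      then show "y \<in> - range t" using t_inv by (metis ComplI DiffE imageI)
    qed
    ultimately have "finite (t ` inv t ` B - B)" "finite (B - t ` inv t ` B)"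
      using fin by (meson finite_imageI finite_subset)+
    then show ?thesis by (simp add: 1 t pfin_class_eq_iff)
  qed
  then have "inv \<tau> x = pim (inv t) x" for x
    using bij by (metis bij_inv_eq_iff)
  then have "inv \<tau> = pim (inv t)" by (rule ext)
  then show ?thesis by (auto simp: trivial_iff_pim)
qed

text \<open>A point crossing between \<open>A\<close> and its complement is mapped into one of two
  finite error sets, and fibres of \<open>h\<close> are finite.\<close>

lemma finite_boundary:
  assumes "boolean_automorphism (pim h)" "pim h (pfin_class A) = pfin_class A"
  shows "finite {x. (x \<in> A) \<noteq> (h x \<in> A)}"
proof -
  have "pim h (pfin_class (- A)) = pfin_class (- A)"
    using assms by (simp add: boolean_isomorphism_def flip: uminus_pfin.abs_eq)
  then have "finite (h ` (- A) - (- A))" by (simp add: pfin_class_eq_iff)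
  moreover have "finite (h ` A - A)" using assms by (simp add: pfin_class_eq_iff)
  ultimately have "finite (\<Union>y \<in> (h ` A - A) \<union> (h ` (- A) - (- A)). h -` {y})"
    using finite_vimage_singleton[OF assms(1)] by simp
  then show ?thesis by (rule rev_finite_subset) auto
qed

lemma pim_eq_self:
  assumes "boolean_automorphism (pim h)" "\<And>x. x \<in> A \<longleftrightarrow> h x \<in> A"
  shows "pim h (pfin_class A) = pfin_class A"
proof -
  have "h ` A - A = {}" "A - h ` A \<subseteq> - range h" using assms(2) by auto
  then show ?thesis
    using finite_compl_range[OF assms(1)] by (auto simp: pfin_class_eq_iff intro: finite_subset)
qed

section \<open>Splitting infinite sets\<close>

lemma infinite_split:
  fixes L :: "nat set"
  assumes "infinite L"
  obtains M N where "M \<union> N = L" "M \<inter> N = {}" "infinite M" "infinite N"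
proof -
  let ?e = "enumerate L"
  have inj: "inj ?e" using assms by (meson strict_mono_enumerate strict_mono_on_imp_inj_on)
  have ran: "range ?e = L" using assms by (rule range_enumerate)
  have "infinite (range (\<lambda>i::nat. 2 * i))" "infinite (range (\<lambda>i::nat. 2 * i + 1))"
    by (auto intro!: range_inj_infinite simp: inj_def)
  then have "infinite (?e ` range (\<lambda>i. 2 * i))" "infinite (?e ` range (\<lambda>i. 2 * i + 1))"
    using inj by (meson finite_imageD inj_on_subset subset_UNIV)+
  moreover have "?e ` range (\<lambda>i. 2 * i) \<inter> ?e ` range (\<lambda>i. 2 * i + 1) = {}"
    using inj by (auto simp: inj_eq) presburger
  moreover have "range (\<lambda>i::nat. 2 * i) \<union> range (\<lambda>i. 2 * i + 1) = UNIV"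
    by (auto simp: image_iff) presburger
  then have "?e ` range (\<lambda>i. 2 * i) \<union> ?e ` range (\<lambda>i. 2 * i + 1) = L"
    using ran by (metis image_Un)
  ultimately show ?thesis using that by blast
qed

text \<open>Finite classes force infinitely many classes inside \<open>G\<close>. Their least
  elements \<open>L\<close> are split into two infinite halves, and one half is saturated.\<close>

lemma infinite_saturated_split:
  fixes G :: "nat set"
  assumes "infinite G" "equiv UNIV R" "R `` G \<subseteq> G" "\<And>x. x \<in> G \<Longrightarrow> finite (R `` {x})"
  obtains G' where "G' \<subseteq> G" "R `` G' \<subseteq> G'" "infinite G'" "infinite (G - G')"
proof -
  have refl: "(x, x) \<in> R" and sym: "(x, y) \<in> R \<Longrightarrow> (y, x) \<in> R"
    and trans: "(x, y) \<in> R \<Longrightarrow> (y, z) \<in> R \<Longrightarrow> (x, z) \<in> R" for x y z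
    using assms(2) by (auto simp: equiv_def refl_on_def dest: symD transD)
  define L where "L = {x \<in> G. \<forall>y. (x, y) \<in> R \<longrightarrow> x \<le> y}"
  have "G \<subseteq> R `` L"
  proof
    fix x assume x: "x \<in> G"
    define y where "y = (LEAST y. (x, y) \<in> R)"
    have y: "(x, y) \<in> R" unfolding y_def using refl by (rule LeastI)
    have "y \<le> z" if "(y, z) \<in> R" for z
      unfolding y_def using trans[OF y that] by (rule Least_le)
    then have "y \<in> L" using x y assms(3) by (auto simp: L_def)
    then show "x \<in> R `` L" using sym[OF y] by auto
  qed
  moreover have "finite (R `` L)" if "finite L"
  proof -
    have "R `` L = (\<Union>x\<in>L. R `` {x})" by auto
    then show ?thesis using that assms(4) by (auto simp: L_def)
  qed
  ultimately have "infinite L" using assms(1) finite_subset by blast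
  then obtain M N where MN: "M \<union> N = L" "M \<inter> N = {}" "infinite M" "infinite N"
    by (rule infinite_split)
  have "N \<inter> R `` M = {}"
  proof (rule ccontr)
    assume "N \<inter> R `` M \<noteq> {}"
    then obtain x y where xy: "x \<in> M" "y \<in> N" "(x, y) \<in> R" by auto
    then have "x \<in> L" "y \<in> L" using MN(1) by auto
    then have "x = y" using xy(3) sym by (auto simp: L_def intro: antisym)
    then show False using xy MN(2) by auto
  qed
  moreover have "L \<subseteq> G" by (auto simp: L_def)
  ultimately have "N \<subseteq> G - R `` M" using MN(1) by auto
  moreover have "M \<subseteq> R `` M" using refl by auto
  moreover have "R `` M \<subseteq> G" using assms(3) \<open>L \<subseteq> G\<close> MN(1) by blast
  moreover have "R `` (R `` M) \<subseteq> R `` M" using trans by blast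
  ultimately show ?thesis using that[of "R `` M"] MN infinite_super by metis
qed

section \<open>Products of three-cycles\<close>

text \<open>For an independent family, \<open>q\<close> is the product of the disjoint three-cycles
  through \<open>a i\<close>, \<open>b i\<close>, \<open>c i\<close>.\<close>

definition rotates :: "('i \<Rightarrow> nat) \<Rightarrow> ('i \<Rightarrow> nat) \<Rightarrow> ('i \<Rightarrow> nat) \<Rightarrow> (nat \<Rightarrow> nat) \<Rightarrow> bool"
  where "rotates a b c q \<longleftrightarrow>
    (\<forall>i. q (a i) = b i \<and> q (b i) = c i \<and> q (c i) = a i) \<and>
    (\<forall>x. x \<notin> range a \<union> range b \<union> range c \<longrightarrow> q x = x)"

text \<open>The infinite complement supplies fixed points, which separate consecutive cycles when
  all of \<omega> is arranged in one sequence.\<close>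

definition independent :: "('i \<Rightarrow> nat) \<Rightarrow> ('i \<Rightarrow> nat) \<Rightarrow> ('i \<Rightarrow> nat) \<Rightarrow> bool"
  where "independent a b c \<longleftrightarrow> inj a \<and> inj b \<and> inj c \<and>
    (\<forall>i j. a i \<noteq> b j \<and> a i \<noteq> c j \<and> b i \<noteq> c j) \<and>
    infinite (- (range a \<union> range b \<union> range c))"

lemma rotates_exists:
  assumes "independent a b c"
  obtains q where "rotates a b c q"
proof -
  define q where "q x = (if x \<in> range a then b (inv a x) else
    if x \<in> range b then c (inv b x) else if x \<in> range c then a (inv c x) else x)" for x
  have "b i \<notin> range a" "c i \<notin> range a" "c i \<notin> range b" for i
    using assms unfolding independent_def by (auto, metis+)
  moreover have "inv a (a i) = i" "inv b (b i) = i" "inv c (c i) = i" for i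
    using assms unfolding independent_def by auto
  ultimately have "rotates a b c q"
    unfolding rotates_def q_def by auto
  then show ?thesis by (rule that)
qed

lemma surj_rotates:
  assumes "rotates a b c q"
  shows "surj q"
proof -
  have "a i \<in> range q" "b i \<in> range q" "c i \<in> range q" for i
    using assms unfolding rotates_def by (metis rangeI)+
  moreover have "x \<in> range q" if "x \<notin> range a \<union> range b \<union> range c" for x
    using assms that unfolding rotates_def by (metis rangeI)
  moreover from calculation have "range a \<union> range b \<union> range c \<subseteq> range q" by blast
  ultimately show ?thesis by blast
qed

text \<open>Enumerates \<omega> in blocks of four; the successor along this enumeration is the
  transitive shift used below.\<close>

definition interleave :: "(nat \<Rightarrow> nat) \<Rightarrow> (nat \<Rightarrow> nat) \<Rightarrow> (nat \<Rightarrow> nat) \<Rightarrow> (nat \<Rightarrow> nat) \<Rightarrow> nat \<Rightarrow> nat"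
  where "interleave d a b c n = (if n mod 4 = 0 then d else if n mod 4 = 1 then a
    else if n mod 4 = 2 then b else c) (n div 4)"

lemma interleave_simps [simp]:
  "interleave d a b c (4 * i) = d i"
  "interleave d a b c (4 * i + 1) = a i"
  "interleave d a b c (Suc (4 * i)) = a i"
  "interleave d a b c (4 * i + 2) = b i"
  "interleave d a b c (Suc (Suc (4 * i))) = b i"
  "interleave d a b c (4 * i + 3) = c i"
  "interleave d a b c (Suc (Suc (Suc (4 * i)))) = c i"
  "interleave d a b c (Suc (Suc (Suc (Suc (4 * i))))) = d (Suc i)"
  by (simp_all add: interleave_def mod_Suc div_Suc)

lemma nat_mod4_cases:
  obtains (0) i where "n = 4 * i" | (1) i where "n = 4 * i + 1"
  | (2) i where "n = 4 * i + 2" | (3) i where "n = 4 * i + (3::nat)"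
proof -
  have n: "n = 4 * (n div 4) + n mod 4" by simp
  have "n mod 4 = 0 \<or> n mod 4 = 1 \<or> n mod 4 = 2 \<or> n mod 4 = 3" by presburger
  then show ?thesis using n that by (elim disjE) (metis add_0_right, metis+)
qed

lemma bij_interleave:
  assumes "inj d" "inj a" "inj b" "inj c"
    and ne: "\<And>i j. d i \<noteq> a j \<and> d i \<noteq> b j \<and> d i \<noteq> c j \<and> a i \<noteq> b j \<and> a i \<noteq> c j \<and> b i \<noteq> c j"
    and covers: "range d \<union> range a \<union> range b \<union> range c = UNIV"
  shows "bij (interleave d a b c)"
proof (rule bijI)
  have ne': "a j \<noteq> d i" "b j \<noteq> d i" "c j \<noteq> d i" "b j \<noteq> a i" "c j \<noteq> a i" "c j \<noteq> b i" for i j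
    using ne by metis+
  show "inj (interleave d a b c)"
  proof (rule injI)
    fix m n assume "interleave d a b c m = interleave d a b c n"
    then show "m = n"
      by (cases m rule: nat_mod4_cases; cases n rule: nat_mod4_cases)
        (simp_all add: ne ne' inj_eq[OF assms(1)] inj_eq[OF assms(2)] inj_eq[OF assms(3)]
          inj_eq[OF assms(4)])
  qed
  have "d i \<in> range (interleave d a b c)" "a i \<in> range (interleave d a b c)"
    "b i \<in> range (interleave d a b c)" "c i \<in> range (interleave d a b c)" for i
    by (metis interleave_simps(1) rangeI, metis interleave_simps(2) rangeI,
        metis interleave_simps(4) rangeI, metis interleave_simps(6) rangeI)
  then have "range d \<union> range a \<union> range b \<union> range c \<subseteq> range (interleave d a b c)" by blast
  then show "surj (interleave d a b c)" using covers by auto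
qed


section \<open>Automorphisms that transport all transitive shifts to trivial maps\<close>

locale trivial_shift_conjugates =
  fixes \<tau> :: "pfin \<Rightarrow> pfin"
  assumes aut: "boolean_automorphism \<tau>"
    \<comment> \<open>The bijection \<open>u\<close> carries \<open>Suc\<close> to an arbitrary
      transitive shift, which \<tau> then transports.\<close>
    and conj_trivial: "bij u \<Longrightarrow> trivial (\<tau> \<circ> pim u \<circ> shift \<circ> inv (\<tau> \<circ> pim u))"
begin

lemma bij_tau: "bij \<tau>"
  using aut by (simp add: boolean_isomorphism_def)

lemma inv_tau [simp]: "inv \<tau> (\<tau> x) = x" "\<tau> (inv \<tau> x) = x"
  using bij_tau by (auto simp: bij_is_inj bij_is_surj surj_f_inv_f)

text \<open>The rotation \<open>q\<close> is a quotient of two transitive shifts: if \<open>d\<close> enumerates its fixed points,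
  then \<open>q\<close> turns \<open>d\<^sub>0 \<rightarrow> a\<^sub>0 \<rightarrow> b\<^sub>0 \<rightarrow> c\<^sub>0 \<rightarrow> d\<^sub>1 \<rightarrow> \<dots>\<close>
  into \<open>d\<^sub>0 \<rightarrow> b\<^sub>0 \<rightarrow> a\<^sub>0 \<rightarrow> c\<^sub>0 \<rightarrow> d\<^sub>1 \<rightarrow> \<dots>\<close>.\<close>

lemma conj_rotation:
  fixes a b c :: "nat \<Rightarrow> nat"
  assumes "independent a b c" "rotates a b c q"
  obtains h where "\<tau> \<circ> pim q \<circ> inv \<tau> = pim h" "boolean_automorphism (pim h)"
proof -
  define D where "D = - (range a \<union> range b \<union> range c)"
  define d where "d = enumerate D"
  have "infinite D" using assms(1) by (simp add: independent_def D_def)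
  then have "inj d" and ran: "range d = D"
    unfolding d_def by (meson strict_mono_enumerate strict_mono_on_imp_inj_on, simp add: range_enumerate)
  have disj: "d i \<noteq> a j \<and> d i \<noteq> b j \<and> d i \<noteq> c j" for i j
    using ran rangeI[of d i] by (auto simp: D_def)
  have cov: "range d \<union> range a \<union> range b \<union> range c = UNIV" "range d \<union> range b \<union> range a \<union> range c = UNIV"
    using ran by (auto simp: D_def)
  have ne: "inj a" "inj b" "inj c" "\<And>i j. a i \<noteq> b j \<and> a i \<noteq> c j \<and> b i \<noteq> c j"
    using assms(1) by (simp_all add: independent_def)
  define u where "u = interleave d a b c"
  define v where "v = interleave d b a c"
  have "bij u" unfolding u_def
    by (rule bij_interleave) (use \<open>inj d\<close> disj ne cov in auto)
  have "b i \<noteq> a j" for i j using ne(4) by metis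
  then have "bij v" unfolding v_def
    by (intro bij_interleave) (use \<open>inj d\<close> disj ne cov in auto)
  have rot: "q (a i) = b i" "q (b i) = c i" "q (c i) = a i" for i
    using assms(2) by (auto simp: rotates_def)
  have fix_d: "q (d i) = d i" for i
    using assms(2) disj[of i] unfolding rotates_def by fastforce
  have inv_v: "inv v (v n) = n" for n using \<open>bij v\<close> by (simp add: bij_is_inj)
  \<comment> \<open>Both successors are taken of the same point \<open>u n\<close>. For instance,
    after \<open>a i\<close> the order \<open>u\<close> continues with \<open>b i\<close>, which
    rotates to \<open>c i\<close>, the next point in the order \<open>v\<close>.\<close>
  have "q (u (Suc n)) = v (Suc (inv v (u n)))" for n
  proof (cases n rule: nat_mod4_cases)
    case (0 i)
    then have "u n = v (4 * i)" by (simp add: u_def v_def)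
    then show ?thesis unfolding \<open>u n = v (4 * i)\<close> inv_v by (simp add: 0 u_def v_def rot)
  next
    case (1 i)
    then have eq: "u n = v (4 * i + 2)" by (simp add: u_def v_def)
    show ?thesis unfolding eq inv_v by (simp add: 1 u_def v_def rot)
  next
    case (2 i)
    then have eq: "u n = v (4 * i + 1)" by (simp add: u_def v_def)
    show ?thesis unfolding eq inv_v by (simp add: 2 u_def v_def rot)
  next
    case (3 i)
    then have eq: "u n = v (4 * i + 3)" by (simp add: u_def v_def)
    \<comment> \<open>The successor enters the next block, whose first point
      \<open>d (Suc i)\<close> is fixed by \<open>q\<close>.\<close>
    have "Suc n = 4 * Suc i" "Suc (4 * i + 3) = 4 * Suc i" using 3 by simp_all
    then show ?thesis unfolding eq inv_v by (simp only: u_def v_def interleave_simps fix_d)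
  qed
  then have key: "q \<circ> (u \<circ> Suc) = v \<circ> (Suc \<circ> (inv v \<circ> u))" by auto
  \<comment> \<open>\<open>F w\<close> is the transport by \<tau> of the shift along
    \<open>w\<close>; \<open>key\<close> will turn the transport of \<open>pim q\<close> into the
    quotient of \<open>F v\<close> by \<open>F u\<close>.\<close>
  define F where "F w = \<tau> \<circ> pim w \<circ> shift \<circ> inv (\<tau> \<circ> pim w)" for w
  have iso: "boolean_automorphism (\<tau> \<circ> pim w)" if "bij w" for w
    using that aut by (intro boolean_isomorphism_comp boolean_isomorphism_pim)
  have F_triv: "trivial (F w)" if "bij w" for w
    unfolding F_def using that by (rule conj_trivial)
  have F_aut: "boolean_automorphism (F w)" if "bij w" for w
    unfolding F_def using iso[OF that]
    by (intro boolean_isomorphism_comp[OF _ boolean_isomorphism_inv]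
        boolean_isomorphism_comp[OF _ boolean_automorphism_shift])
  have F_apply: "F w (\<tau> (pim w y)) = \<tau> (pim w (shift y))" if "bij w" for w y
  proof -
    have "inj (\<tau> \<circ> pim w)" using iso[OF that] by (simp add: boolean_isomorphism_def bij_is_inj)
    then have "inv (\<tau> \<circ> pim w) ((\<tau> \<circ> pim w) y) = y" by (rule inv_f_f)
    then show ?thesis by (simp add: F_def)
  qed
  have "\<tau> (pim q (inv \<tau> (F u x))) = F v x" for x
  proof -
    have "surj (\<tau> \<circ> pim u)" using iso[OF \<open>bij u\<close>] unfolding boolean_isomorphism_def by (blast dest: bij_is_surj)
    then obtain y where y: "x = \<tau> (pim u y)" by (metis comp_apply surjD)
    \<comment> \<open>Rewrites \<open>x\<close> in the coordinates of \<open>v\<close>, so that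
      \<open>F_apply\<close> also computes \<open>F v x\<close>.\<close>
    have "v \<circ> (inv v \<circ> u) = u"
      using \<open>bij v\<close> by (auto simp: bij_is_surj surj_f_inv_f)
    then have "x = \<tau> (pim v (pim (inv v \<circ> u) y))"
      by (simp add: y pim_pim)
    then have "F v x = \<tau> (pim v (shift (pim (inv v \<circ> u) y)))"
      using F_apply[OF \<open>bij v\<close>] by simp
    also have "\<dots> = \<tau> (pim (q \<circ> (u \<circ> Suc)) y)"
      by (simp only: shift_eq_pim pim_pim key)
    also have "\<dots> = \<tau> (pim q (inv \<tau> (F u x)))"
      by (simp only: y F_apply[OF \<open>bij u\<close>] inv_tau shift_eq_pim pim_pim)
    finally show ?thesis by simp
  qed
  moreover have "F u (inv (F u) x) = x" for x
    using F_aut[OF \<open>bij u\<close>] by (simp add: boolean_isomorphism_def bij_is_surj surj_f_inv_f)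
  ultimately have "(\<tau> \<circ> pim q \<circ> inv \<tau>) x = (F v \<circ> inv (F u)) x" for x
    by (metis comp_apply)
  then have "\<tau> \<circ> pim q \<circ> inv \<tau> = F v \<circ> inv (F u)" by (rule ext)
  moreover have "trivial (F v \<circ> inv (F u))"
    using F_aut F_triv \<open>bij u\<close> \<open>bij v\<close> by (intro trivial_comp trivial_inv)
  moreover have "boolean_automorphism (F v \<circ> inv (F u))"
    using F_aut \<open>bij u\<close> \<open>bij v\<close> by (intro boolean_isomorphism_comp boolean_isomorphism_inv)
  ultimately show ?thesis using that by (metis trivial_iff_pim)
qed

section \<open>Triviality below a set\<close>

definition trivial_on :: "nat set \<Rightarrow> bool"
  where "trivial_on T \<longleftrightarrow> (\<exists>t. \<forall>Z \<subseteq> T. \<tau> (pfin_class Z) = pfin_class (t ` Z))"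

lemma trivial_on_subset: "trivial_on T \<Longrightarrow> S \<subseteq> T \<Longrightarrow> trivial_on S"
  unfolding trivial_on_def by (meson subset_trans)

text \<open>Since \<tau> preserves joins, the two point maps can be glued, with \<open>s\<close>
  taking precedence on the overlap.\<close>

lemma trivial_on_Un:
  assumes "trivial_on S" "trivial_on T"
  shows "trivial_on (S \<union> T)"
proof -
  obtain s t where s: "\<And>Z. Z \<subseteq> S \<Longrightarrow> \<tau> (pfin_class Z) = pfin_class (s ` Z)"
    and t: "\<And>Z. Z \<subseteq> T \<Longrightarrow> \<tau> (pfin_class Z) = pfin_class (t ` Z)"
    using assms unfolding trivial_on_def by blast
  have "\<tau> (pfin_class Z) = pfin_class ((\<lambda>x. if x \<in> S then s x else t x) ` Z)" if "Z \<subseteq> S \<union> T" for Z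
  proof -
    have "pfin_class Z = sup (pfin_class (Z \<inter> S)) (pfin_class (Z - S))"
      by (simp add: sup_pfin.abs_eq Int_Diff_Un)
    then have "\<tau> (pfin_class Z) = sup (\<tau> (pfin_class (Z \<inter> S))) (\<tau> (pfin_class (Z - S)))"
      using aut by (simp add: boolean_isomorphism_def)
    also have "\<dots> = pfin_class (s ` (Z \<inter> S) \<union> t ` (Z - S))"
      using that s[of "Z \<inter> S"] t[of "Z - S"] by (simp add: sup_pfin.abs_eq Diff_subset_conv)
    also have "s ` (Z \<inter> S) \<union> t ` (Z - S) = (\<lambda>x. if x \<in> S then s x else t x) ` Z"
      by auto
    finally show ?thesis .
  qed
  then show ?thesis unfolding trivial_on_def by blast
qed

text \<open>A product of three-cycles maps \<open>S\<close> onto \<open>T\<close>, and its transport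
  by \<tau> is some \<open>pim h\<close>. So \<tau> on \<open>T\<close> is: go back to
  \<open>S\<close>, apply \<open>s\<close>, then apply \<open>h\<close>.\<close>

lemma trivial_on_move:
  assumes "trivial_on S" "infinite S" "infinite T" "S \<inter> T = {}" "infinite (- (S \<union> T))"
  shows "trivial_on T"
proof -
  \<comment> \<open>\<open>U\<close> holds the third points of the cycles, \<open>V\<close>
    infinitely many fixed points.\<close>
  obtain U V where UV: "U \<union> V = - (S \<union> T)" "U \<inter> V = {}" "infinite U" "infinite V"
    using infinite_split[OF assms(5)] by metis
  have enum: "inj (enumerate L)" "range (enumerate L) = L" if "infinite L" for L :: "nat set"
    using that by (meson strict_mono_enumerate strict_mono_on_imp_inj_on, simp add: range_enumerate)
  define a b c where "a = enumerate S" and "b = enumerate T" and "c = enumerate U"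
  have inj: "inj a" "inj b" "inj c" and ran: "range a = S" "range b = T" "range c = U"
    using enum assms UV by (auto simp: a_def b_def c_def)
  have mem: "a i \<in> S" "b i \<in> T" "c i \<in> U" for i using ran by auto
  have "V \<subseteq> - (range a \<union> range b \<union> range c)" using ran UV by blast
  then have "infinite (- (range a \<union> range b \<union> range c))" using UV(4) infinite_super by blast
  moreover have "S \<inter> U = {}" "T \<inter> U = {}" using UV by auto
  then have "a i \<noteq> b j \<and> a i \<noteq> c j \<and> b i \<noteq> c j" for i j
    using mem[of i] mem[of j] assms(4) by (metis disjoint_iff)
  ultimately have "independent a b c" using inj by (simp add: independent_def)
  then obtain q where q: "rotates a b c q" by (rule rotates_exists)
  obtain h where h: "\<tau> \<circ> pim q \<circ> inv \<tau> = pim h"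
    using conj_rotation[OF \<open>independent a b c\<close> q] by metis
  obtain s where s: "\<And>Z. Z \<subseteq> S \<Longrightarrow> \<tau> (pfin_class Z) = pfin_class (s ` Z)"
    using assms(1) unfolding trivial_on_def by blast
  have "\<tau> (pfin_class Z) = pfin_class ((h \<circ> s \<circ> a \<circ> inv b) ` Z)" if "Z \<subseteq> T" for Z
  proof -
    define Y where "Y = a ` inv b ` Z"
    have "q (a (inv b z)) = z" if "z \<in> Z" for z
      using q that \<open>Z \<subseteq> T\<close> ran by (metis f_inv_into_f rotates_def subsetD)
    then have "q ` Y = Z" by (auto simp: Y_def image_image)
    then have "\<tau> (pfin_class Z) = (\<tau> \<circ> pim q \<circ> inv \<tau>) (\<tau> (pfin_class Y))" by simp
    also have "\<dots> = pim h (pfin_class (s ` Y))"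
      unfolding h using s[of Y] mem by (simp add: Y_def image_subset_iff)
    finally show ?thesis by (simp add: Y_def image_comp)
  qed
  then show ?thesis unfolding trivial_on_def by blast
qed

text \<open>Passing to one half \<open>T\<close> of \<open>S\<close> makes the complement infinite
  even if \<open>S\<close> is cofinite. Each half of the complement is reached from
  \<open>T\<close>, the other half serving as the spare room.\<close>

lemma trivial_if_trivial_on:
  assumes "trivial_on S" "infinite S"
  shows "trivial \<tau>"
proof -
  obtain T T' where T: "T \<union> T' = S" "T \<inter> T' = {}" "infinite T" "infinite T'"
    using infinite_split[OF assms(2)] by metis
  have "T' \<subseteq> - T" using T by auto
  then have "infinite (- T)" using T(4) infinite_super by blast
  then obtain U V where UV: "U \<union> V = - T" "U \<inter> V = {}" "infinite U" "infinite V"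
    by (rule infinite_split)
  have "trivial_on T" using assms(1) T by (blast intro: trivial_on_subset)
  moreover have "- (T \<union> U) = V" "- (T \<union> V) = U" using UV by auto
  ultimately have "trivial_on U" "trivial_on V"
    using trivial_on_move[of T U] trivial_on_move[of T V] T UV by auto
  then have "trivial_on (T \<union> (U \<union> V))" using \<open>trivial_on T\<close> by (intro trivial_on_Un)
  moreover have "T \<union> (U \<union> V) = UNIV" using UV by auto
  ultimately show ?thesis by (auto simp: trivial_on_def trivial_def)
qed

end


section \<open>Coding points by columns\<close>

text \<open>Pairing divides \<omega> into infinitely many infinite columns, with \<open>m\<close> as
  the height in column \<open>n\<close>.\<close>

definition cell :: "nat \<Rightarrow> nat \<Rightarrow> nat"
  where "cell n m = prod_encode (n, m)"

definition col :: "nat \<Rightarrow> nat"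
  where "col k = fst (prod_decode k)"

lemma cell_eq_iff [simp]: "cell n m = cell n' m' \<longleftrightarrow> n = n' \<and> m = m'"
  by (simp add: cell_def)

lemma col_cell [simp]: "col (cell n m) = n"
  by (simp add: cell_def col_def)

lemma cell_cases: obtains n m where "k = cell n m"
  by (metis cell_def prod.collapse prod_decode_inverse)

text \<open>The index \<open>i\<close> is itself decoded into a column and a block of four rows, so
  one family of cycles acts in all columns at once. The cells at offset \<open>p + 3\<close> stay
  free.\<close>

lemma independent_cells:
  "independent (\<lambda>i. cell (col i) (4 * snd (prod_decode i) + p))
    (\<lambda>i. cell (col i) (4 * snd (prod_decode i) + p + 1))
    (\<lambda>i. cell (col i) (4 * snd (prod_decode i) + p + 2))"
proof -
  define row where "row i = snd (prod_decode i)" for i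
  have eqI: "i = j" if "col i = col j" "row i = row j" for i j
    using that unfolding col_def row_def by (metis prod.expand prod_decode_inverse)
  have inj: "inj (\<lambda>i. cell (col i) (4 * row i + r))" for r
    by (rule injI) (auto intro: eqI)
  have "range (\<lambda>i. cell (col i) (4 * row i + (p + 3))) \<subseteq>
    - (range (\<lambda>i. cell (col i) (4 * row i + p)) \<union> range (\<lambda>i. cell (col i) (4 * row i + p + 1)) \<union>
       range (\<lambda>i. cell (col i) (4 * row i + p + 2)))"
    by auto presburger+
  then have "infinite (- (range (\<lambda>i. cell (col i) (4 * row i + p)) \<union>
    range (\<lambda>i. cell (col i) (4 * row i + p + 1)) \<union> range (\<lambda>i. cell (col i) (4 * row i + p + 2))))"
    using range_inj_infinite[OF inj] infinite_super by blast
  moreover have "4 * row i + p \<noteq> 4 * row j + p + 1" "4 * row i + p \<noteq> 4 * row j + p + 2"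
    "4 * row i + p + 1 \<noteq> 4 * row j + p + 2" for i j
    by presburger+
  ultimately show ?thesis
    using inj[of p] inj[of "p + 1"] inj[of "p + 2"]
    unfolding independent_def row_def[symmetric] by (simp add: add.assoc)
qed

text \<open>This expresses that a column is connected and one-ended: above a finite height the maps
  \<open>q i\<close> climb the column without changing membership in \<open>E\<close>, which is
  therefore eventually constant.\<close>

lemma finite_or_cofinite_in_column:
  fixes q :: "'i::finite \<Rightarrow> nat \<Rightarrow> nat"
  assumes "\<And>i. finite {k. (k \<in> E) \<noteq> (q i k \<in> E)}"
    and step: "\<And>m. \<exists>i. q i (cell n m) = cell n (Suc m)"
    and "finite (E - col -` {n})"
  shows "finite E \<or> finite (col -` {n} - E)"
proof -
  define B where "B = (\<Union>i. {k. (k \<in> E) \<noteq> (q i k \<in> E)})"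
  have "finite B" using assms(1) by (simp add: B_def)
  then have "finite (cell n -` B)" by (rule finite_vimageI) (simp add: inj_def)
  then obtain M where M: "\<And>m. m \<in> cell n -` B \<Longrightarrow> m < M"
    by (metis finite_nat_bounded lessThan_iff subsetD)
  have const: "cell n m \<in> E \<longleftrightarrow> cell n M \<in> E" if "M \<le> m" for m
    using that
  proof (induction rule: dec_induct)
    case (step m)
    then have "cell n m \<notin> B" using M[of m] by auto
    obtain i where i: "q i (cell n m) = cell n (Suc m)" using assms(2) by blast
    have "cell n m \<in> E \<longleftrightarrow> q i (cell n m) \<in> E"
      using \<open>cell n m \<notin> B\<close> by (simp add: B_def)
    then show ?case using step.IH i by simp
  qed simp
  have column: "k \<in> cell n ` {..<M}" if "col k = n" "(k \<in> E) \<noteq> (cell n M \<in> E)" for k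
  proof (cases k rule: cell_cases)
    case (1 n' m)
    with that have "k = cell n m" by simp
    moreover have "\<not> M \<le> m" using const[of m] that(2) calculation by blast
    ultimately show ?thesis by simp
  qed
  show ?thesis
  proof (cases "cell n M \<in> E")
    case True
    then have "col -` {n} - E \<subseteq> cell n ` {..<M}" using column by blast
    then show ?thesis using finite_subset by blast
  next
    case False
    then have "E \<subseteq> (E - col -` {n}) \<union> cell n ` {..<M}" using column by blast
    then show ?thesis by (rule disjI1[OF finite_subset]) (simp add: assms(3))
  qed
qed

section \<open>Components of an action restricted to a set\<close>

definition linked :: "('i \<Rightarrow> nat \<Rightarrow> nat) \<Rightarrow> nat set \<Rightarrow> (nat \<times> nat) set"
  where "linked h A = {(x, y) \<in> A \<times> A. \<exists>i. y = h i x \<or> x = h i y}"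

text \<open>Links run in both directions, so the closure is symmetric. Its classes are the
  components inside \<open>A\<close>, together with one singleton for each point outside.\<close>

lemma equiv_linked: "equiv UNIV ((linked h A)\<^sup>*)"
proof -
  have "sym (linked h A)" by (auto simp: sym_def linked_def)
  then show ?thesis by (simp add: equiv_def refl_on_def sym_rtrancl trans_rtrancl)
qed

lemma linked_mem: "(x, y) \<in> (linked h A)\<^sup>* \<Longrightarrow> x \<in> A \<Longrightarrow> y \<in> A"
  by (induction rule: rtrancl_induct) (auto simp: linked_def)

lemma linked_out: "(x, y) \<in> (linked h A)\<^sup>* \<Longrightarrow> x \<notin> A \<Longrightarrow> y = x"
  by (induction rule: rtrancl_induct) (auto simp: linked_def)

text \<open>If all components were finite, discarding the finitely many that meet the boundary would
  leave an infinite union of components. Half of these components would form an invariant set,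
  contradicting indecomposability.\<close>

lemma infinite_component:
  fixes h :: "'i::finite \<Rightarrow> nat \<Rightarrow> nat"
  assumes "infinite A"
    and boundary: "\<And>i. finite {x. (x \<in> A) \<noteq> (h i x \<in> A)}"
    and indecomposable: "\<And>G. G \<subseteq> A \<Longrightarrow> infinite G \<Longrightarrow> infinite (A - G) \<Longrightarrow>
      \<not> (\<forall>i x. x \<in> G \<longleftrightarrow> h i x \<in> G)"
  shows "\<exists>x \<in> A. infinite ((linked h A)\<^sup>* `` {x})"
proof (rule ccontr)
  let ?R = "(linked h A)\<^sup>*"
  assume "\<not> ?thesis"
  then have "finite (?R `` {x})" if "x \<in> A" for x using that by blast
  moreover have "?R `` {x} \<subseteq> {x}" if "x \<notin> A" for x
    using that linked_out by blast
  ultimately have fin: "finite (?R `` {x})" for x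
    by (metis finite.emptyI finite.insertI finite_subset)
  define C where "C = (\<Union>i. {x. (x \<in> A) \<noteq> (h i x \<in> A)})"
  \<comment> \<open>Images of boundary points are included so that \<open>h i x\<close> lying
    outside \<open>B\<close> already keeps \<open>x\<close> off the boundary.\<close>
  define B where "B = C \<union> (\<Union>i. h i ` C)"
  have "finite B" using boundary by (simp add: B_def C_def)
  moreover have "?R `` B = (\<Union>x\<in>B. ?R `` {x})" by auto
  ultimately have "finite (?R `` B)" using fin by simp
  then have "infinite (A - ?R `` B)" using assms(1) by simp
  have sym: "(y, x) \<in> ?R" if "(x, y) \<in> ?R" for x y
    using that equiv_linked by (metis equivE symD)
  have "?R `` (A - ?R `` B) \<subseteq> A - ?R `` B"
  proof
    fix y assume "y \<in> ?R `` (A - ?R `` B)"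
    then obtain x where x: "x \<in> A" "x \<notin> ?R `` B" "(x, y) \<in> ?R" by auto
    then have "y \<notin> ?R `` B" using sym by (blast intro: rtrancl_trans)
    then show "y \<in> A - ?R `` B" using x linked_mem by blast
  qed
  then obtain G where G: "G \<subseteq> A - ?R `` B" "?R `` G \<subseteq> G" "infinite G" "infinite (A - ?R `` B - G)"
    using infinite_saturated_split[OF \<open>infinite (A - ?R `` B)\<close> equiv_linked] fin by metis
  have "G \<inter> B = {}" "G \<subseteq> A" using G(1) by auto
  have "x \<in> G \<longleftrightarrow> h i x \<in> G" for i x
  proof
    assume "x \<in> G"
    then have "x \<in> A" "x \<notin> C" using \<open>G \<inter> B = {}\<close> \<open>G \<subseteq> A\<close> by (auto simp: B_def)
    then have "(x, h i x) \<in> linked h A" by (auto simp: C_def linked_def)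
    then show "h i x \<in> G" using G(2) \<open>x \<in> G\<close> by blast
  next
    assume *: "h i x \<in> G"
    then have "h i x \<in> A" "x \<notin> C" using \<open>G \<inter> B = {}\<close> \<open>G \<subseteq> A\<close> by (auto simp: B_def)
    then have "(h i x, x) \<in> linked h A" by (auto simp: C_def linked_def)
    then show "x \<in> G" using G(2) * by blast
  qed
  moreover have "infinite (A - G)"
    using G(4) by (rule contrapos_nn) (rule finite_subset[rotated], auto)
  ultimately show False using indecomposable[OF \<open>G \<subseteq> A\<close> G(3)] by blast
qed

section \<open>Column indices read off from single points\<close>

locale column_action = trivial_shift_conjugates +
  \<comment> \<open>Two maps suffice, hence the index type \<open>bool\<close>: jointly the
    \<open>q i\<close> climb every column, and the \<open>h i\<close> are their transports by
    \<tau>.\<close>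
  fixes q h :: "bool \<Rightarrow> nat \<Rightarrow> nat"
  assumes conj: "\<tau> (pim (q i) x) = pim (h i) (\<tau> x)"
    and aut_q: "boolean_automorphism (pim (q i))"
    and aut_h: "boolean_automorphism (pim (h i))"
    and surj_q: "surj (q i)"
    and col_q: "col (q i k) = col k"
    and step: "\<exists>i. q i (cell n m) = cell n (Suc m)"
begin

lemma pim_q_columns: "pim (q i) (pfin_class (col -` S)) = pfin_class (col -` S)"
proof -
  have "q i ` (col -` S) = col -` S"
  proof
    show "col -` S \<subseteq> q i ` (col -` S)"
    proof
      fix k assume "k \<in> col -` S"
      moreover obtain j where "k = q i j" using surj_q by (metis surjD)
      ultimately show "k \<in> q i ` (col -` S)" using col_q by auto
    qed
  qed (auto simp: col_q)
  then show ?thesis by simp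
qed

lemma boundary_columns:
  assumes "\<tau> (pfin_class (col -` S)) = pfin_class A"
  shows "finite {x. (x \<in> A) \<noteq> (h i x \<in> A)}"
proof (rule finite_boundary[OF aut_h])
  show "pim (h i) (pfin_class A) = pfin_class A"
    by (metis assms conj pim_q_columns)
qed

lemma infinite_column: "infinite (col -` {n})"
proof -
  have "range (cell n) \<subseteq> col -` {n}" by auto
  moreover have "infinite (range (cell n))" by (rule range_inj_infinite) (simp add: inj_def)
  ultimately show ?thesis using infinite_super by blast
qed

lemma tau_bot: "\<tau> bot = bot" and tau_inf: "\<tau> (inf x y) = inf (\<tau> x) (\<tau> y)"
  using aut by (simp_all add: boolean_isomorphism_def)

lemma tau_eq_bot_iff: "\<tau> x = bot \<longleftrightarrow> x = bot"
  by (metis inv_tau(1) tau_bot)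

text \<open>An invariant splitting of \<open>A\<close> into two infinite parts would pull back along
  \<tau> to an almost invariant splitting of the column, which
  \<open>finite_or_cofinite_in_column\<close> excludes.\<close>

lemma column_component:
  assumes A: "\<tau> (pfin_class (col -` {n})) = pfin_class A"
  shows "\<exists>x \<in> A. infinite ((linked h A)\<^sup>* `` {x})"
proof (rule infinite_component)
  show "infinite A"
    using A infinite_column[of n] by (metis pfin_class_eq_bot_iff tau_eq_bot_iff)
  show "finite {x. (x \<in> A) \<noteq> (h i x \<in> A)}" for i
    using A by (rule boundary_columns)
next
  fix G assume G: "G \<subseteq> A" "infinite G" "infinite (A - G)"
  show "\<not> (\<forall>i x. x \<in> G \<longleftrightarrow> h i x \<in> G)"
  proof
    assume "\<forall>i x. x \<in> G \<longleftrightarrow> h i x \<in> G"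
    then have inv: "pim (h i) (pfin_class G) = pfin_class G" for i
      using pim_eq_self[OF aut_h] by blast
    obtain E where E: "\<tau> (pfin_class E) = pfin_class G"
      by (metis inv_tau(2) pfin_cases)
    have "pim (q i) (pfin_class E) = pfin_class E" for i
      by (metis E inv conj inv_tau(1))
    then have "finite {k. (k \<in> E) \<noteq> (q i k \<in> E)}" for i
      using finite_boundary[OF aut_q] by blast
    moreover have "finite (E - col -` {n})"
    proof -
      have "pfin_class G \<le> pfin_class A"
        using G(1) by (simp add: pfin_class_le_iff Diff_eq_empty_iff[THEN iffD2])
      then show ?thesis
        using boolean_isomorphism_le_iff[OF aut] E A by (metis pfin_class_le_iff)
    qed
    ultimately have "finite E \<or> finite (col -` {n} - E)"
      using finite_or_cofinite_in_column step by blast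
    then show False
    proof
      assume "finite E"
      then show False using E G(2) by (metis pfin_class_eq_bot_iff tau_bot)
    next
      assume "finite (col -` {n} - E)"
      then show False
        using boolean_isomorphism_le_iff[OF aut] E A G(3) by (metis pfin_class_le_iff)
    qed
  qed
qed

text \<open>\<open>K n\<close> is chosen in an infinite component of a representative of the image
  of column \<open>n\<close>. The finite boundary of \<open>A\<close> misses all but finitely many
  of these components, and each component missed lies on one side of \<open>A\<close>.\<close>

lemma coded_points:
  obtains K where "inj K"
    "\<And>S A. \<tau> (pfin_class (col -` S)) = pfin_class A \<Longrightarrow> finite {n. (K n \<in> A) \<noteq> (n \<in> S)}"
proof -
  have "\<exists>A. \<tau> (pfin_class (col -` {n})) = pfin_class A" for n by (metis pfin_cases)
  then obtain A0 where A0: "\<And>n. \<tau> (pfin_class (col -` {n})) = pfin_class (A0 n)" by metis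
  have ad: "finite (A \<inter> B)" if "\<tau> (pfin_class X) = pfin_class A" "\<tau> (pfin_class Y) = pfin_class B"
    "X \<inter> Y = {}" for X Y A B
  proof -
    have "pfin_class (A \<inter> B) = \<tau> (pfin_class (X \<inter> Y))"
      using tau_inf[of "pfin_class X" "pfin_class Y"] that(1,2) by (simp add: inf_pfin.abs_eq)
    also have "\<dots> = bot" unfolding that(3) by (simp add: tau_eq_bot_iff pfin_class_eq_bot_iff)
    finally show ?thesis by (simp add: pfin_class_eq_bot_iff)
  qed
  \<comment> \<open>Subtracting the earlier representatives makes them truly disjoint and changes
    each only finitely.\<close>
  define A where "A n = A0 n - (\<Union>m<n. A0 m)" for n
  have A: "\<tau> (pfin_class (col -` {n})) = pfin_class (A n)" for n
  proof -
    have "finite (A0 n \<inter> A0 m)" if "m < n" for m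
      using ad[OF A0 A0, of n m] that by auto
    then have "finite (\<Union>m<n. A0 n \<inter> A0 m)" by (intro finite_UN_I) auto
    moreover have "A0 n - A n = (\<Union>m<n. A0 n \<inter> A0 m)" "A n - A0 n = {}"
      by (auto simp: A_def)
    ultimately have "pfin_class (A0 n) = pfin_class (A n)" by (simp only: pfin_class_eq_iff finite.emptyI)
    then show ?thesis using A0 by simp
  qed
  have disj: "m = n" if "x \<in> A m" "x \<in> A n" for m n x
    using that by (cases m n rule: linorder_cases) (auto simp: A_def)
  have "\<forall>n. \<exists>x. x \<in> A n \<and> infinite ((linked h (A n))\<^sup>* `` {x})"
    using column_component[OF A] by blast
  then obtain K where K: "\<And>n. K n \<in> A n" "\<And>n. infinite ((linked h (A n))\<^sup>* `` {K n})" by metis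
  define D where "D n = (linked h (A n))\<^sup>* `` {K n}" for n
  have D_sub: "D n \<subseteq> A n" for n using linked_mem[OF _ K(1)] by (auto simp: D_def)
  have D_inf: "infinite (D n)" for n using K(2) by (simp add: D_def)
  have "inj K" by (rule injI) (metis K(1) disj)
  moreover have "finite {n. (K n \<in> B) \<noteq> (n \<in> S)}"
    if B: "\<tau> (pfin_class (col -` S)) = pfin_class B" for S B
  proof -
    define C where "C = (\<Union>i. {x. (x \<in> B) \<noteq> (h i x \<in> B)})"
    have "finite C" using boundary_columns[OF B] by (simp add: C_def)
    \<comment> \<open>By disjointness each boundary point spoils at most one index.\<close>
    moreover have "finite {n. x \<in> A n}" for x
    proof (cases "\<exists>m. x \<in> A m")
      case True
      then obtain m where "x \<in> A m" ..
      then have "{n. x \<in> A n} \<subseteq> {m}" using disj by auto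
      then show ?thesis using finite_subset by blast
    qed simp
    ultimately have "finite (\<Union>x\<in>C. {n. x \<in> A n})" by simp
    moreover have "{n. (K n \<in> B) \<noteq> (n \<in> S)} \<subseteq> (\<Union>x\<in>C. {n. x \<in> A n})"
    proof
      fix n assume n: "n \<in> {n. (K n \<in> B) \<noteq> (n \<in> S)}"
      show "n \<in> (\<Union>x\<in>C. {n. x \<in> A n})"
      proof (rule ccontr)
        assume "n \<notin> (\<Union>x\<in>C. {n. x \<in> A n})"
        then have DC: "D n \<inter> C = {}" using D_sub by auto
        have const: "y \<in> B \<longleftrightarrow> K n \<in> B" if "y \<in> D n" for y
        proof -
          have "(K n, y) \<in> (linked h (A n))\<^sup>*" using that by (simp add: D_def)
          then show ?thesis
          proof (induction rule: rtrancl_induct)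
            case (step y z)
            then have "y \<in> D n" "z \<in> D n" by (auto simp: D_def)
            then have "y \<notin> C" "z \<notin> C" using DC by auto
            then have "y \<in> B \<longleftrightarrow> z \<in> B" using step(2) by (auto simp: C_def linked_def)
            then show ?case using step.IH by simp
          qed simp
        qed
        \<comment> \<open>\<open>B\<close> contains almost all or almost none of \<open>A n\<close>,
          according to \<open>n \<in> S\<close>. The infinite set \<open>D n\<close>, on which
          membership in \<open>B\<close> is constant, must take the same side.\<close>
        show False
        proof (cases "n \<in> S")
          case True
          then have "pfin_class (col -` {n}) \<le> pfin_class (col -` S)"
            by (simp add: pfin_class_le_iff Diff_eq_empty_iff[THEN iffD2] vimage_mono)
          then have "finite (A n - B)"
            using boolean_isomorphism_le_iff[OF aut] A B by (metis pfin_class_le_iff)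
          then have "\<not> D n \<subseteq> A n - B" using D_inf finite_subset by blast
          then show False using D_sub const n True by blast
        next
          case False
          then have "finite (A n \<inter> B)" using ad[OF A B, of n] by auto
          then have "\<not> D n \<subseteq> A n \<inter> B" using D_inf finite_subset by blast
          then show False using D_sub const n False by blast
        qed
      qed
    qed
    ultimately show ?thesis using finite_subset by blast
  qed
  ultimately show ?thesis by (rule that)
qed

text \<open>By \<open>coded\<close>, \<tau> acts below \<open>T\<close> as
  \<open>K \<circ> col\<close>, at least on sets that contain whole traces of columns on
  \<open>T\<close>. The set \<open>L\<close> has one point in each nonempty trace, and turns out to
  be almost all of \<open>T\<close>.\<close>

lemma trivial_on_exists: "\<exists>T. infinite T \<and> trivial_on T"
proof -
  obtain K where K: "inj K"
    "\<And>S A. \<tau> (pfin_class (col -` S)) = pfin_class A \<Longrightarrow> finite {n. (K n \<in> A) \<noteq> (n \<in> S)}"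
    by (rule coded_points) blast
  obtain T where T: "\<tau> (pfin_class T) = pfin_class (range K)"
    by (metis inv_tau(2) pfin_cases)
  have coded: "\<tau> (pfin_class (T \<inter> col -` S)) = pfin_class (K ` S)" for S
  proof -
    obtain A where A: "\<tau> (pfin_class (col -` S)) = pfin_class A" by (metis pfin_cases)
    have "\<tau> (pfin_class (T \<inter> col -` S)) = pfin_class (range K \<inter> A)"
      using tau_inf[of "pfin_class T" "pfin_class (col -` S)"] by (simp add: T A inf_pfin.abs_eq)
    also have "\<dots> = pfin_class (K ` S)"
    proof -
      have "finite (K ` {n. (K n \<in> A) \<noteq> (n \<in> S)})" using K(2)[OF A] by simp
      moreover have "range K \<inter> A - K ` S \<subseteq> K ` {n. (K n \<in> A) \<noteq> (n \<in> S)}"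
        "K ` S - range K \<inter> A \<subseteq> K ` {n. (K n \<in> A) \<noteq> (n \<in> S)}" by auto
      ultimately show ?thesis unfolding pfin_class_eq_iff using finite_subset by blast
    qed
    finally show ?thesis .
  qed
  have tau_inj: "x = y" if "\<tau> x = \<tau> y" for x y using that by (metis inv_tau(1))
  have fin_col: "finite (T \<inter> col -` {n})" for n
  proof -
    have "\<tau> (pfin_class (T \<inter> col -` {n})) = bot"
      unfolding coded by (simp add: pfin_class_eq_bot_iff)
    then show ?thesis by (simp add: tau_eq_bot_iff pfin_class_eq_bot_iff)
  qed
  define L where "L = {t \<in> T. \<forall>s \<in> T. col s = col t \<longrightarrow> t \<le> s}"
  have "L \<subseteq> T" by (auto simp: L_def)
  have inj_L: "s = t" if "s \<in> L" "t \<in> L" "col s = col t" for s t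
    using that by (auto simp: L_def intro: antisym)
  have least: "\<exists>s \<in> L. col s = col t" if "t \<in> T" for t
  proof -
    define s where "s = (LEAST s. s \<in> T \<and> col s = col t)"
    have "s \<in> T \<and> col s = col t" unfolding s_def by (rule LeastI[of _ t]) (simp add: that)
    moreover have "s \<le> r" if "r \<in> T" "col r = col t" for r
      unfolding s_def using that by (intro Least_le) simp
    ultimately show ?thesis by (auto simp: L_def)
  qed
  obtain U where U: "\<tau> (pfin_class L) = pfin_class U" by (metis pfin_cases)
  \<comment> \<open>The image of \<open>L\<close> lies below the class of \<open>range K\<close>,
    hence is the class of some image under \<open>K\<close>. Thus \<open>L\<close> almost equals a
    union of whole column traces.\<close>
  have "pfin_class L = inf (pfin_class L) (pfin_class T)"
    using \<open>L \<subseteq> T\<close> by (simp add: inf_pfin.abs_eq Int_absorb2)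
  then have "\<tau> (pfin_class L) = inf (pfin_class U) (pfin_class (range K))"
    by (metis T U tau_inf)
  also have "\<dots> = pfin_class (K ` (K -` U))"
    by (simp add: inf_pfin.abs_eq image_vimage_eq)
  finally have "pfin_class L = pfin_class (T \<inter> col -` (K -` U))"
    unfolding coded[symmetric] by (rule tau_inj)
  then have fin: "finite (L - T \<inter> col -` (K -` U))" "finite (T \<inter> col -` (K -` U) - L)"
    by (simp_all only: pfin_class_eq_iff)
  \<comment> \<open>A point of \<open>T - L\<close> either belongs to that union of traces, or
    shares its finite trace with one of the finitely many points of \<open>L\<close> outside the
    union.\<close>
  have "T - L \<subseteq> (T \<inter> col -` (K -` U) - L) \<union> (\<Union>s \<in> L - T \<inter> col -` (K -` U). T \<inter> col -` {col s})"
  proof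
    fix t assume t: "t \<in> T - L"
    then obtain s where s: "s \<in> L" "col s = col t" using least by blast
    show "t \<in> (T \<inter> col -` (K -` U) - L) \<union> (\<Union>s \<in> L - T \<inter> col -` (K -` U). T \<inter> col -` {col s})"
    proof (cases "K (col t) \<in> U")
      case False
      then have "s \<in> L - T \<inter> col -` (K -` U)" using s by auto
      then show ?thesis using s t by fastforce
    qed (use t in auto)
  qed
  then have "finite (T - L)" using fin fin_col finite_subset by (metis (no_types, lifting) finite_UN finite_Un)
  have "infinite T"
  proof
    assume "finite T"
    then have "finite (range K)" by (metis T pfin_class_eq_bot_iff tau_bot)
    then show False using range_inj_infinite[OF K(1)] by simp
  qed
  then have "infinite L" using \<open>finite (T - L)\<close> by (metis Diff_infinite_finite)
  moreover have "\<tau> (pfin_class Z) = pfin_class ((K \<circ> col) ` Z)" if "Z \<subseteq> L" for Z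
  proof -
    have "Z - T \<inter> col -` (col ` Z) = {}" using that \<open>L \<subseteq> T\<close> by auto
    \<comment> \<open>Saturating \<open>Z\<close> by columns adds no point of \<open>L\<close>,
      which meets each column at most once.\<close>
    moreover have "T \<inter> col -` (col ` Z) - Z \<subseteq> T - L"
      using that inj_L by auto
    then have "finite (T \<inter> col -` (col ` Z) - Z)"
      using \<open>finite (T - L)\<close> finite_subset by blast
    ultimately have "pfin_class Z = pfin_class (T \<inter> col -` (col ` Z))"
      by (simp only: pfin_class_eq_iff finite.emptyI)
    then show ?thesis by (simp add: coded image_comp)
  qed
  then have "trivial_on L" unfolding trivial_on_def by blast
  ultimately show ?thesis by blast
qed

end

section \<open>Two rotations that climb every column\<close>

lemma (in trivial_shift_conjugates) trivial_tau: "trivial \<tau>"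
proof -
  define g where "g p i = cell (col i) (4 * snd (prod_decode i) + p)" for p i
  have g: "independent (g p) (g (p + 1)) (g (p + 2))" for p
    using independent_cells[of p] by (simp add: g_def[abs_def] add.assoc)
  \<comment> \<open>Cycles at offsets 0 and 2 overlap in single rows: in each block one map climbs
    from row 0 to 2, the other from row 2 to 4, the start of the next block.\<close>
  define p :: "bool \<Rightarrow> nat" where "p i = (if i then 0 else 2)" for i
  have "\<exists>q. rotates (g (p i)) (g (p i + 1)) (g (p i + 2)) q" for i
    using rotates_exists[OF g] by metis
  then obtain q where q: "\<And>i. rotates (g (p i)) (g (p i + 1)) (g (p i + 2)) (q i)" by metis
  have "\<exists>h. \<tau> \<circ> pim (q i) \<circ> inv \<tau> = pim h \<and> boolean_automorphism (pim h)" for i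
    using conj_rotation[OF g q] by metis
  then obtain h where h: "\<And>i. \<tau> \<circ> pim (q i) \<circ> inv \<tau> = pim (h i)"
    "\<And>i. boolean_automorphism (pim (h i))" by metis
  interpret column_action \<tau> q h
  proof
    fix i n m k
    show conj: "\<tau> (pim (q i) x) = pim (h i) (\<tau> x)" for x
      by (simp add: h(1)[symmetric])
    \<comment> \<open>Conjugating back, \<open>pim (q i)\<close> inherits being an automorphism from
      \<open>pim (h i)\<close>.\<close>
    have "pim (q i) = inv \<tau> \<circ> pim (h i) \<circ> \<tau>"
      by (rule ext) (simp flip: conj)
    then show "boolean_automorphism (pim (q i))"
      using aut h(2) by (simp add: boolean_isomorphism_comp boolean_isomorphism_inv)
    show "boolean_automorphism (pim (h i))" by (rule h)
    show "surj (q i)" using q by (rule surj_rotates)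
    have col_g: "col (g r j) = col j" for r j by (simp add: g_def)
    have rot: "q i (g (p i) j) = g (p i + 1) j" "q i (g (p i + 1) j) = g (p i + 2) j"
      "q i (g (p i + 2) j) = g (p i) j" for i j
      using q[of i] by (simp_all add: rotates_def)
    show "col (q i k) = col k"
    proof (cases "k \<in> range (g (p i)) \<union> range (g (p i + 1)) \<union> range (g (p i + 2))")
      case True
      then show ?thesis by (elim UnE rangeE) (simp_all only: rot col_g)
    next
      case False
      then show ?thesis using q[of i] by (simp add: rotates_def)
    qed
    \<comment> \<open>The index of the block of four rows in column \<open>n\<close> that contains
      row \<open>m\<close>, and below it the first row of that block.\<close>
    define j where "j = cell n (m div 4)"
    define l where "l = 4 * (m div 4)"
    have gj: "g r j = cell n (l + r)" for r by (simp add: g_def j_def l_def cell_def col_def)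
    have "q True (cell n l) = cell n (l + 1)" "q True (cell n (l + 1)) = cell n (l + 2)"
      "q False (cell n (l + 2)) = cell n (l + 3)" "q False (cell n (l + 3)) = cell n (l + 4)"
      using rot(1,2)[of True j] rot(1,2)[of False j]
      by (simp_all add: p_def gj eval_nat_numeral)
    moreover have "m = l \<or> m = l + 1 \<or> m = l + 2 \<or> m = l + 3"
      unfolding l_def by presburger
    moreover have "Suc l = l + 1" "Suc (l + 1) = l + 2" "Suc (l + 2) = l + 3" "Suc (l + 3) = l + 4"
      by simp_all
    ultimately show "\<exists>i. q i (cell n m) = cell n (Suc m)" by metis
  qed
  show ?thesis using trivial_on_exists trivial_if_trivial_on by blast
qed

theorem theorem12p11:
  assumes "\<exists>\<tau>. nontrivial_automorphism \<tau>"
  shows "(\<exists>\<phi>. nontrivial_automorphism \<phi> \<and> \<phi> \<circ> shift = shift \<circ> \<phi>) \<or>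
    (\<exists>\<psi>. nontrivial_automorphism \<psi> \<and> conjugate \<psi> shift)"
proof (rule ccontr)
  assume neg: "\<not> ?thesis"
  obtain \<tau> where \<tau>: "boolean_automorphism \<tau>" "\<not> trivial \<tau>"
    using assms by (auto simp: nontrivial_automorphism_def)
  interpret trivial_shift_conjugates \<tau>
  proof
    show "boolean_automorphism \<tau>" by (rule \<tau>)
    fix u :: "nat \<Rightarrow> nat" assume "bij u"
    define \<rho> where "\<rho> = \<tau> \<circ> pim u"
    have \<rho>: "boolean_automorphism \<rho>"
      unfolding \<rho>_def using \<tau>(1) \<open>bij u\<close> by (intro boolean_isomorphism_comp boolean_isomorphism_pim)
    have "boolean_automorphism (\<rho> \<circ> shift \<circ> inv \<rho>)"
      using \<rho> by (intro boolean_isomorphism_comp boolean_isomorphism_inv boolean_automorphism_shift)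
    \<comment> \<open>The conjugating isomorphism is \<open>inv \<rho>\<close>; were the transported
      shift nontrivial, it would witness the second alternative, contrary to
      \<open>neg\<close>.\<close>
    moreover have "inv \<rho> \<circ> (\<rho> \<circ> shift \<circ> inv \<rho>) = shift \<circ> inv \<rho>"
      using \<rho> by (auto simp: boolean_isomorphism_def bij_is_inj)
    then have "conjugate (\<rho> \<circ> shift \<circ> inv \<rho>) shift"
      unfolding conjugate_def using \<rho> boolean_isomorphism_inv by blast
    ultimately have "trivial (\<rho> \<circ> shift \<circ> inv \<rho>)"
      using neg by (auto simp: nontrivial_automorphism_def)
    then show "trivial (\<tau> \<circ> pim u \<circ> shift \<circ> inv (\<tau> \<circ> pim u))" by (simp add: \<rho>_def)
  qed
  show False using trivial_tau \<tau>(2) by contradiction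
qed

end
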